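(* Let $q>0$ be an integer, let $X$ be a vertex transitive $(q+1)$-regular graph, and fix a vertex $x_0$ of $X$. Let $N_m^0$ denote the number of closed geodesics of length $m$ in $X$ with base point (starting vertex) $x_0$. Then for all $t\ge0$ $$K_X(t,x_0,x_0)=K_{q+1}(t,x_0,x_0)+e^{-(q+1)t}\sum_{m=1}^{\infty}N_m^0\,q^{-m/2}\,I_m(2\sqrt{q}\,t),$$ where $K_X$ is the heat kernel of $X$ and $K_{q+1}(t,x_0,x_0)$ denotes the value on the diagonal (at any vertex) of the heat kernel of the $(q+1)$-regular tree.
   Context: A graph $X$ consists of a set $VX$ of vertices, a set $EX$ of (oriented) edges, maps $o,t:EX\to VX$ (origin and terminus), and a map $y\mapsto\overline{y}$ on $EX$ with $\overline{\overline{y}}=y$, $\overline{y}\ne y$, $o(y)=t(\overline{y})$ for all $y\in EX$ (loops and multiple edges are allowed). The degree of a vertex $x$ is the number of $y\in EX$ with $o(y)=x$; $X$ is $d$-regular if every vertex has degree $d$. $X$ is vertex transitive if there is a group of automorphisms acting transitively on the vertices. The graph may be finite or infinite. A path of length $n$ is a sequence of edges $y_0,\dots,y_{n-1}$ with $t(y_i)=o(y_{i+1})$; it has backtracking if $y_{i+1}=\overline{y_i}$ for some $i$, and it has a tail if $y_0=\overline{y_{n-1}}$. It is closed if its initial and final vertices agree. A geodesic is a path without backtracking. A closed geodesic is a closed path with no backtracking and no tail. A tree is a connected nonempty graph without closed geodesic paths of positive length. For a $(q+1)$-regular graph $X$, the Laplacian on functions $f:VX\to\mathbb{R}$ is $\Delta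 f(x)=(q+1)f(x)-\sum_{e:\,o(e)=x} f(t(e))$. The heat kernel $K_X(t,x_0,x)$, $t\ge 0$, is the unique bounded solution of $\Delta K_X(t,x_0,x)+\frac{\partial}{\partial t}K_X(t,x_0,x)=0$ (with $\Delta$ acting in $x$), $K_X(0,x_0,x)=1$ if $x=x_0$ and $0$ otherwise. For an integer $m\ge0$, $I_m(t)=\sum_{n=0}^\infty \frac{(t/2)^{2n+m}}{n!\,\Gamma(n+1+m)}$ is the $I$-Bessel function of order $m$. *)

theory Defs
  imports
    "HOL-Analysis.Gamma_Function"
    "HOL-Algebra.Group_Action"
    "Graph_Theory.Bidirected_Digraph"
    "Graph_Theory.Arc_Walk"
    "Graph_Theory.Digraph_Component"
begin

text \<open>
  A graph with vertex set \<open>VX\<close>, oriented edges \<open>EX\<close>, origin and terminus maps and a fixed-point-free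
  edge inversion is \<open>bidirected_digraph G bar\<close>: \<open>verts G\<close>, \<open>arcs G\<close>, \<open>tail G\<close> (origin),
  \<open>head G\<close> (terminus), \<open>bar\<close> (inversion).  Loops, multiple edges and infinite graphs are
  allowed.  The locale also makes \<open>bar\<close> the identity outside \<open>arcs G\<close>, which is only a
  normalisation.  Paths are arc walks: \<open>pre_digraph.awalk G u p v\<close> says that the edge list \<open>p\<close> is
  a path from \<open>u\<close> to \<open>v\<close>.
\<close>

text \<open>Finiteness is explicit because the cardinality of an infinite set is \<open>0\<close>.\<close>

definition regular_graph :: "('v, 'e) pre_digraph \<Rightarrow> nat \<Rightarrow> bool" where
  "regular_graph G d \<longleftrightarrow> (\<forall>x\<in>verts G. finite (out_arcs G x) \<and> out_degree G x = d)"

abbreviation vert_arc_bij_group ::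
    "('v, 'e) pre_digraph \<Rightarrow> (('v \<Rightarrow> 'v) \<times> ('e \<Rightarrow> 'e)) monoid" where
  "vert_arc_bij_group G \<equiv> BijGroup (verts G) \<times>\<times> BijGroup (arcs G)"

definition graph_automorphisms ::
    "('v, 'e) pre_digraph \<Rightarrow> ('e \<Rightarrow> 'e) \<Rightarrow> (('v \<Rightarrow> 'v) \<times> ('e \<Rightarrow> 'e)) set" where
  "graph_automorphisms G bar =
     {(\<phi>, \<psi>) \<in> carrier (vert_arc_bij_group G).
        \<forall>e\<in>arcs G. tail G (\<psi> e) = \<phi> (tail G e) \<and> head G (\<psi> e) = \<phi> (head G e) \<and>
                     \<psi> (bar e) = bar (\<psi> e)}"

definition vertex_transitive :: "('v, 'e) pre_digraph \<Rightarrow> ('e \<Rightarrow> 'e) \<Rightarrow> bool" where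
  "vertex_transitive G bar \<longleftrightarrow>
     (\<exists>\<Gamma>. \<Gamma> \<subseteq> graph_automorphisms G bar \<and> subgroup \<Gamma> (vert_arc_bij_group G) \<and>
          transitive_action ((vert_arc_bij_group G)\<lparr>carrier := \<Gamma>\<rparr>) (verts G) fst)"

definition has_backtracking :: "('e \<Rightarrow> 'e) \<Rightarrow> 'e list \<Rightarrow> bool" where
  "has_backtracking bar p \<longleftrightarrow> (\<exists>i. Suc i < length p \<and> p ! Suc i = bar (p ! i))"

definition has_tail :: "('e \<Rightarrow> 'e) \<Rightarrow> 'e list \<Rightarrow> bool" where
  "has_tail bar p \<longleftrightarrow> p \<noteq> [] \<and> hd p = bar (last p)"

definition closed_geodesic ::
    "('v, 'e) pre_digraph \<Rightarrow> ('e \<Rightarrow> 'e) \<Rightarrow> 'v \<Rightarrow> 'e list \<Rightarrow> bool" where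
  "closed_geodesic G bar x p \<longleftrightarrow>
     pre_digraph.awalk G x p x \<and> \<not> has_backtracking bar p \<and> \<not> has_tail bar p"

definition num_closed_geodesics ::
    "('v, 'e) pre_digraph \<Rightarrow> ('e \<Rightarrow> 'e) \<Rightarrow> 'v \<Rightarrow> nat \<Rightarrow> nat" where
  "num_closed_geodesics G bar x m = card {p. closed_geodesic G bar x p \<and> length p = m}"

text \<open>
  \<open>strongly_connected\<close> says that there is a vertex and that any two vertices are joined by a path of
  oriented edges; in the presence of an edge inversion this is connectedness.
\<close>

definition tree_graph :: "('v, 'e) pre_digraph \<Rightarrow> ('e \<Rightarrow> 'e) \<Rightarrow> bool" where
  "tree_graph G bar \<longleftrightarrow> bidirected_digraph G bar \<and> strongly_connected G \<and>
     \<not> (\<exists>x p. closed_geodesic G bar x p \<and> length p > 0)"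

definition laplacian :: "nat \<Rightarrow> ('v, 'e) pre_digraph \<Rightarrow> ('v \<Rightarrow> real) \<Rightarrow> 'v \<Rightarrow> real" where
  "laplacian q G f x = (real q + 1) * f x - (\<Sum>e\<in>out_arcs G x. f (head G e))"

text \<open>The time derivative at \<open>t = 0\<close> is one-sided.\<close>

definition bounded_heat_solution ::
    "nat \<Rightarrow> ('v, 'e) pre_digraph \<Rightarrow> 'v \<Rightarrow> (real \<Rightarrow> 'v \<Rightarrow> real) \<Rightarrow> bool" where
  "bounded_heat_solution q G x0 u \<longleftrightarrow>
     (\<exists>C. \<forall>t\<ge>0. \<forall>x\<in>verts G. \<bar>u t x\<bar> \<le> C) \<and>
     (\<forall>t\<ge>0. \<forall>x\<in>verts G. \<exists>D. ((\<lambda>s. u s x) has_real_derivative D) (at t within {0..}) \<and>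
        laplacian q G (u t) x + D = 0) \<and>
     (\<forall>x\<in>verts G. u 0 x = (if x = x0 then 1 else 0))"

text \<open>
  The kernel is a function on \<open>{0..} \<times> verts G\<close>; the value \<open>0\<close> elsewhere is a convention that makes
  the HOL function unique.
\<close>

definition heat_kernel ::
    "nat \<Rightarrow> ('v, 'e) pre_digraph \<Rightarrow> real \<Rightarrow> 'v \<Rightarrow> 'v \<Rightarrow> real" where
  "heat_kernel q G t x0 x =
     (THE u. bounded_heat_solution q G x0 u \<and> (\<forall>s y. s < 0 \<or> y \<notin> verts G \<longrightarrow> u s y = 0)) t x"

definition I_Bessel :: "nat \<Rightarrow> real \<Rightarrow> real" where
  "I_Bessel m t = (\<Sum>n. (t / 2) ^ (2 * n + m) / (fact n * Gamma (real (n + 1 + m))))"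

end

theory Submission
  imports Defs
begin

text \<open>
  The Laplacian is \<open>q + 1 - A\<close> with \<open>A\<close> the adjacency operator.  It is bounded on bounded functions, so
  the heat kernel is \<open>exp (-(q+1) t)\<close> times \<open>exp (t A)\<close>, whose Taylor coefficients count walks
  (\<open>heat_kernel_eq_walk_series\<close>).  Since \<open>q^(-m/2) I_m(2 sqrt q t)\<close> has the coefficient
  \<open>(n choose j) q^j / n!\<close> at \<open>t^n\<close> with \<open>n = m + 2 j\<close> (\<open>I_Bessel_sums\<close>), the theorem is equivalent to a
  statement about numbers of closed walks: those of length \<open>n\<close> at \<open>x0\<close> in \<open>X\<close> exceed those in the tree by
  the sum of \<open>(n choose j) q^j N_m\<close> over \<open>m + 2 j = n\<close>, \<open>m > 0\<close> (\<open>num_walks_closed_geodesics\<close>).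

  The walk numbers are universal combinations of the numbers \<open>c_m\<close> of closed paths without backtracking,
  tails being allowed (\<open>num_walks_conv_geodesics\<close>).  In the tree \<open>c_m = 0\<close> for \<open>m > 0\<close>
  (\<open>card_geodesics_tree\<close>), so the tree contributes exactly the term with \<open>m = 0\<close>.

  It remains to pass from \<open>c_m\<close> to \<open>N_m\<close>.  The relation is \<open>c_{m+2} - q c_m = N_{m+2} - N_m\<close> for \<open>m > 0\<close>
  (\<open>closed_geodesic_recurrence\<close>), obtained by counting the ways to attach a tail to a closed path.  A
  tail moves the base point to a neighbouring vertex, so the count has to be carried along edges.
  Vertex transitivity enters in the form that \<open>c_m\<close> is the same at all vertices: it implies that
  equally many tailed paths of given length start with an edge and with its inverse
  (\<open>card_tailed_from_arc_bar\<close>).  The relation then converts the weights of the \<open>c_m\<close>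
  into binomial coefficients (\<open>sum_walk_weight_eq_sum_bessel_weight\<close>).
\<close>

section \<open>Geodesics in regular graphs\<close>

lemma has_backtracking_Nil [simp]: "\<not> has_backtracking bar []"
  by (simp add: has_backtracking_def)

lemma has_backtracking_Cons:
  "has_backtracking bar (e # p) \<longleftrightarrow> (p \<noteq> [] \<and> hd p = bar e) \<or> has_backtracking bar p"
  unfolding has_backtracking_def
proof (intro iffI; elim disjE exE)
  fix i assume *: "Suc i < length (e # p) \<and> (e # p) ! Suc i = bar ((e # p) ! i)"
  show "(p \<noteq> [] \<and> hd p = bar e) \<or> (\<exists>i. Suc i < length p \<and> p ! Suc i = bar (p ! i))"
    using * by (cases i) (auto simp: hd_conv_nth)
next
  assume "p \<noteq> [] \<and> hd p = bar e"
  then show "\<exists>i. Suc i < length (e # p) \<and> (e # p) ! Suc i = bar ((e # p) ! i)"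
    by (intro exI[of _ 0]) (auto simp: hd_conv_nth)
next
  fix i assume "Suc i < length p \<and> p ! Suc i = bar (p ! i)"
  then show "\<exists>i. Suc i < length (e # p) \<and> (e # p) ! Suc i = bar ((e # p) ! i)"
    by (intro exI[of _ "Suc i"]) auto
qed

lemma has_backtracking_append:
  "has_backtracking bar (p @ r) \<longleftrightarrow>
     has_backtracking bar p \<or> has_backtracking bar r \<or>
     (p \<noteq> [] \<and> r \<noteq> [] \<and> hd r = bar (last p))"
  by (induction p) (auto simp: has_backtracking_Cons hd_append)

lemma has_backtracking_map:
  assumes "set p \<subseteq> A" "inj_on f A" "\<And>e. e \<in> A \<Longrightarrow> bar e \<in> A"
    and "\<And>e. e \<in> A \<Longrightarrow> f (bar e) = bar' (f e)"
  shows "has_backtracking bar' (map f p) \<longleftrightarrow> has_backtracking bar p"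
  using assms(1)
proof (induction p)
  case (Cons e p)
  have "f (hd p) = bar' (f e) \<longleftrightarrow> hd p = bar e" if "p \<noteq> []"
    using that Cons.prems assms(2-4) by (metis hd_in_set inj_onD list.set_intros subsetD)
  then show ?case using Cons by (auto simp: has_backtracking_Cons hd_map)
qed simp

context bidirected_digraph
begin

lemma awalk_reverse: "awalk x p y \<Longrightarrow> awalk y (map arev (rev p)) x"
proof (induction p arbitrary: x)
  case Nil
  then show ?case by (auto simp: awalk_Nil_iff)
next
  case (Cons e p)
  then have "awalk y (map arev (rev p)) (head G e)" "awalk (head G e) [arev e] x"
    by (auto simp: awalk_Cons_iff awalk_Nil_iff)
  then show ?case by (simp add: awalk_appendI)
qed

lemma has_backtracking_reverse:
  "has_backtracking arev (map arev (rev p)) \<longleftrightarrow> has_backtracking arev p"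
  by (induction p)
    (auto simp: has_backtracking_Cons has_backtracking_append last_map last_rev hd_rev arev_eq_iff)

lemma reverse_reverse: "map arev (rev (map arev (rev p))) = p"
  by (simp add: rev_map)

definition geodesics :: "'a \<Rightarrow> nat \<Rightarrow> 'a \<Rightarrow> 'b list set" where
  "geodesics x m y = {p. awalk x p y \<and> \<not> has_backtracking arev p \<and> length p = m}"

text \<open>
  The closed paths without backtracking that start with the edge \<open>e\<close> fall into two classes,
  according to whether the last edge is the inverse of \<open>e\<close>: the closed geodesics and the tailed ones.
\<close>

definition geodesics_from_arc :: "'b \<Rightarrow> nat \<Rightarrow> 'b list set" where
  "geodesics_from_arc e m =
     {p. closed_geodesic G arev (tail G e) p \<and> length p = m \<and> p \<noteq> [] \<and> hd p = e}"

definition tailed_from_arc :: "'b \<Rightarrow> nat \<Rightarrow> 'b list set" where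
  "tailed_from_arc e m =
     {p \<in> geodesics (tail G e) m (tail G e). p \<noteq> [] \<and> hd p = e \<and> last p = arev e}"

end

locale regular_bidirected_graph = bidirected_digraph G bar
  for G :: "('v, 'e) pre_digraph" and bar +
  fixes q :: nat
  assumes regular: "regular_graph G (q + 1)"
begin

lemma finite_out_arcs: "x \<in> verts G \<Longrightarrow> finite (out_arcs G x)"
  and card_out_arcs: "x \<in> verts G \<Longrightarrow> card (out_arcs G x) = q + 1"
  using regular by (auto simp: regular_graph_def out_degree_def)

lemma finite_awalks: "x \<in> verts G \<Longrightarrow> finite {p. awalk x p y \<and> length p = m}"
proof (induction m arbitrary: x)
  case 0
  have "{p. awalk x p y \<and> length p = 0} \<subseteq> {[]}" by auto
  then show ?case by (rule finite_subset) simp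
next
  case (Suc m)
  have "{p. awalk x p y \<and> length p = Suc m} \<subseteq>
      (\<Union>e\<in>out_arcs G x. (#) e ` {p. awalk (head G e) p y \<and> length p = m})"
    by (auto simp: length_Suc_conv awalk_Cons_iff)
  then show ?case
    by (rule finite_subset) (use Suc finite_out_arcs in auto)
qed

lemma finite_geodesics: "x \<in> verts G \<Longrightarrow> finite (geodesics x m y)"
  by (rule finite_subset[OF _ finite_awalks[of x y m]]) (auto simp: geodesics_def)

lemma geodesics_0: "x \<in> verts G \<Longrightarrow> geodesics x 0 y = (if x = y then {[]} else {})"
  by (auto simp: geodesics_def awalk_Nil_iff)

lemma card_geodesics_Suc:
  assumes "x \<in> verts G"
  shows "card (geodesics x (Suc m) y) =
    (\<Sum>e\<in>out_arcs G x. card {p \<in> geodesics (head G e) m y. p = [] \<or> hd p \<noteq> bar e})"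
proof -
  have eq: "geodesics x (Suc m) y =
      (\<Union>e\<in>out_arcs G x. (#) e ` {p \<in> geodesics (head G e) m y. p = [] \<or> hd p \<noteq> bar e})"
    by (auto simp: geodesics_def length_Suc_conv awalk_Cons_iff has_backtracking_Cons)
  show ?thesis unfolding eq
    by (subst card_UN_disjoint)
       (auto simp: finite_out_arcs assms finite_geodesics card_image)
qed

lemma card_geodesics_return:
  assumes e: "e \<in> out_arcs G x"
  shows "card {p \<in> geodesics (head G e) (Suc k) y. p \<noteq> [] \<and> hd p = bar e} =
         card {p \<in> geodesics x k y. p = [] \<or> hd p \<noteq> e}"
proof -
  have "{p \<in> geodesics (head G e) (Suc k) y. p \<noteq> [] \<and> hd p = bar e} =
        (#) (bar e) ` {p \<in> geodesics x k y. p = [] \<or> hd p \<noteq> e}"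
    using e by (auto simp: geodesics_def length_Suc_conv awalk_Cons_iff has_backtracking_Cons)
  then show ?thesis by (simp add: card_image)
qed

text \<open>
  In terms of the matrices \<open>A_m\<close> that count geodesics of length \<open>m\<close>, this is
  \<open>A_1 A_{k+1} = A_{k+2} + q A_k\<close>, with \<open>q + 1\<close> in place of \<open>q\<close> for \<open>k = 0\<close>.  Putting an edge \<open>e\<close> in
  front of a geodesic either gives a longer geodesic, or the geodesic begins with the inverse of
  \<open>e\<close> and both edges cancel.  A nonempty geodesic arises by cancellation for every \<open>e\<close> except its own
  first edge, the empty one for every \<open>e\<close>.
\<close>

lemma geodesic_recurrence:
  assumes x: "x \<in> verts G"
  shows "(\<Sum>e\<in>out_arcs G x. card (geodesics (head G e) (Suc k) y)) =
    card (geodesics x (Suc (Suc k)) y) + (if k = 0 then q + 1 else q) * card (geodesics x k y)"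
proof -
  let ?O = "out_arcs G x"
  have fin: "finite ?O" "finite (geodesics x k y)"
    using x by (auto simp: finite_out_arcs finite_geodesics)
  have "(\<Sum>e\<in>?O. card (geodesics (head G e) (Suc k) y)) =
    (\<Sum>e\<in>?O. card {p \<in> geodesics (head G e) (Suc k) y. p = [] \<or> hd p \<noteq> bar e} +
             card {p \<in> geodesics (head G e) (Suc k) y. p \<noteq> [] \<and> hd p = bar e})"
    by (intro sum.cong refl, subst card_Un_disjoint[symmetric])
       (auto simp: finite_geodesics intro!: arg_cong[where f = card])
  also have "\<dots> = card (geodesics x (Suc (Suc k)) y) +
      (\<Sum>e\<in>?O. card {p \<in> geodesics x k y. p = [] \<or> hd p \<noteq> e})"
    by (simp add: sum.distrib card_geodesics_Suc[OF x] card_geodesics_return)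
  also have "(\<Sum>e\<in>?O. card {p \<in> geodesics x k y. p = [] \<or> hd p \<noteq> e}) =
      (\<Sum>e\<in>?O. \<Sum>p\<in>geodesics x k y. if p = [] \<or> hd p \<noteq> e then 1 else 0)"
    using fin by (simp add: sum.If_cases Int_def)
  also have "\<dots> = (\<Sum>p\<in>geodesics x k y. card {e \<in> ?O. p = [] \<or> hd p \<noteq> e})"
    using fin by (subst sum.swap) (simp add: sum.If_cases Int_def)
  also have "\<dots> = (\<Sum>p\<in>geodesics x k y. if k = 0 then q + 1 else q)"
  proof (intro sum.cong refl)
    fix p assume p: "p \<in> geodesics x k y"
    show "card {e \<in> ?O. p = [] \<or> hd p \<noteq> e} = (if k = 0 then q + 1 else q)"
    proof (cases p)
      case Nil
      then show ?thesis using p card_out_arcs[OF x] by (simp add: geodesics_def out_arcs_def)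
    next
      case (Cons a r)
      then have "a \<in> ?O" "k \<noteq> 0"
        using p by (auto simp: geodesics_def awalk_Cons_iff)
      moreover have "{e \<in> ?O. p = [] \<or> hd p \<noteq> e} = ?O - {a}"
        using Cons by auto
      ultimately show ?thesis using x by (simp add: card_out_arcs)
    qed
  qed
  finally show ?thesis by simp
qed

end

section \<open>Walks as combinations of geodesics\<close>

context regular_bidirected_graph
begin

primrec num_walks :: "nat \<Rightarrow> 'v \<Rightarrow> 'v \<Rightarrow> nat" where
  "num_walks 0 x y = of_bool (x = y)"
| "num_walks (Suc n) x y = (\<Sum>e\<in>out_arcs G x. num_walks n (head G e) y)"

lemma num_walks_le: "x \<in> verts G \<Longrightarrow> num_walks n x y \<le> (q + 1) ^ n"
proof (induction n arbitrary: x)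
  case (Suc n)
  have "num_walks (Suc n) x y \<le> (\<Sum>e\<in>out_arcs G x. (q + 1) ^ n)"
    unfolding num_walks.simps by (intro sum_mono Suc.IH) auto
  then show ?case using Suc.prems by (simp add: card_out_arcs)
qed simp

end

text \<open>
  Writing \<open>A_1^n\<close> as a combination of the \<open>A_m\<close> by means of \<open>A_1 A_m = A_{m+1} + q A_{m-1}\<close> gives
  coefficients that depend on \<open>q\<close> alone: the coefficient of \<open>A_m\<close> counts the walks of length \<open>n\<close> in the
  \<open>(q+1)\<close>-regular tree between two given vertices at distance \<open>m\<close>.
\<close>

fun walk_weight :: "nat \<Rightarrow> nat \<Rightarrow> nat \<Rightarrow> nat" where
  "walk_weight q 0 m = of_bool (m = 0)"
| "walk_weight q (Suc n) 0 = (q + 1) * walk_weight q n 1"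
| "walk_weight q (Suc n) (Suc m) = walk_weight q n m + q * walk_weight q n (m + 2)"

lemma walk_weight_eq_0: "n < m \<Longrightarrow> walk_weight q n m = 0"
  by (induction q n m rule: walk_weight.induct) auto

context regular_bidirected_graph
begin

lemma num_walks_conv_geodesics:
  "x \<in> verts G \<Longrightarrow> num_walks n x y = (\<Sum>m\<le>n. walk_weight q n m * card (geodesics x m y))"
proof (induction n arbitrary: x)
  case 0
  then show ?case by (simp add: geodesics_0)
next
  case (Suc n)
  let ?c = "\<lambda>m. card (geodesics x m y)" and ?w = "walk_weight q n"
  have "num_walks (Suc n) x y =
      (\<Sum>m\<le>n. ?w m * (\<Sum>e\<in>out_arcs G x. card (geodesics (head G e) m y)))"
    by (simp add: Suc.IH sum_distrib_left sum.swap[of _ "{..n}"])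
  also have "\<dots> = (\<Sum>m\<le>Suc n. ?w m * (\<Sum>e\<in>out_arcs G x. card (geodesics (head G e) m y)))"
    by (simp add: walk_weight_eq_0)
  also have "\<dots> = ?w 0 * ?c 1 +
      (\<Sum>m\<le>n. ?w (Suc m) * (?c (Suc (Suc m)) + (if m = 0 then q + 1 else q) * ?c m))"
  proof -
    have "(\<Sum>e\<in>out_arcs G x. card (geodesics (head G e) 0 y)) = ?c 1"
      using card_geodesics_Suc[OF Suc.prems, of 0 y]
      by (auto simp: geodesics_def cong: conj_cong intro!: sum.cong arg_cong[where f = card])
    then show ?thesis
      by (subst sum.atMost_Suc_shift) (simp add: geodesic_recurrence[OF Suc.prems] del: sum.atMost_Suc)
  qed
  also have "\<dots> = (?w 0 * ?c 1 + (\<Sum>m\<le>n. ?w (Suc m) * ?c (Suc (Suc m)))) +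
      (\<Sum>m\<le>n. ?w (Suc m) * ((if m = 0 then q + 1 else q) * ?c m))"
    by (simp add: algebra_simps sum.distrib)
  also have "?w 0 * ?c 1 + (\<Sum>m\<le>n. ?w (Suc m) * ?c (Suc (Suc m))) =
      (\<Sum>m\<le>Suc n. ?w m * ?c (Suc m))"
    by (subst sum.atMost_Suc_shift) simp
  also have "\<dots> = (\<Sum>m\<le>n. ?w m * ?c (Suc m))"
    by (simp add: walk_weight_eq_0)
  also have "(\<Sum>m\<le>n. ?w (Suc m) * ((if m = 0 then q + 1 else q) * ?c m)) =
      (\<Sum>m\<le>Suc n. ?w (Suc m) * ((if m = 0 then q + 1 else q) * ?c m))"
    by (simp add: walk_weight_eq_0)
  also have "\<dots> = (q + 1) * ?w 1 * ?c 0 + (\<Sum>m\<le>n. q * ?w (m + 2) * ?c (Suc m))"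
    by (subst sum.atMost_Suc_shift) (simp add: algebra_simps)
  also have "(\<Sum>m\<le>n. ?w m * ?c (Suc m)) +
      ((q + 1) * ?w 1 * ?c 0 + (\<Sum>m\<le>n. q * ?w (m + 2) * ?c (Suc m))) =
      (\<Sum>m\<le>Suc n. walk_weight q (Suc n) m * ?c m)"
    by (subst sum.atMost_Suc_shift) (simp add: algebra_simps sum.distrib)
  finally show ?case .
qed

end

section \<open>Closed geodesics and tails\<close>

context bidirected_digraph
begin

lemma tailed_from_arc_small: "m \<le> 2 \<Longrightarrow> tailed_from_arc e m = {}"
proof (intro equals0I)
  fix p assume m: "m \<le> 2" and p: "p \<in> tailed_from_arc e m"
  then obtain r where r: "p = e # r"
    by (cases p) (auto simp: tailed_from_arc_def)
  then have e: "arev e \<noteq> e"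
    using p by (auto simp: tailed_from_arc_def geodesics_def awalk_Cons_iff arev_neq)
  show False
  proof (cases r)
    case Nil
    then show False using p r e by (simp add: tailed_from_arc_def)
  next
    case (Cons a s)
    then have "s = []"
      using m p r by (cases s) (simp_all add: tailed_from_arc_def geodesics_def)
    then show False
      using p r Cons by (auto simp: tailed_from_arc_def geodesics_def has_backtracking_Cons)
  qed
qed

text \<open>
  Moving the first edge \<open>e\<close> to the end turns a closed geodesic at the origin of \<open>e\<close> into one at its
  terminus, because the absence of a tail is the absence of backtracking at the base point.
  Reversing the result gives a closed geodesic that starts with the inverse of \<open>e\<close>.
\<close>

lemma rotate_reverse_geodesic:
  assumes e: "e \<in> arcs G" and p: "p \<in> geodesics_from_arc e m"
  shows "arev e # map arev (rev (tl p)) \<in> geodesics_from_arc (arev e) m"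
proof -
  obtain r where r: "p = e # r" using p by (cases p) (auto simp: geodesics_from_arc_def)
  have w: "awalk (head G e) r (tail G e)" and nb: "\<not> has_backtracking arev (e # r)"
    and nt: "\<not> has_tail arev (e # r)" and len: "m = Suc (length r)"
    using p by (auto simp: r geodesics_from_arc_def closed_geodesic_def awalk_Cons_iff)
  have "awalk (head G e) (arev e # map arev (rev r)) (head G e)"
    using e awalk_reverse[OF w] by (simp add: awalk_Cons_iff)
  moreover have "\<not> has_backtracking arev (arev e # map arev (rev r))"
    using nb nt by (auto simp: has_backtracking_Cons has_backtracking_reverse has_tail_def
        hd_map hd_rev arev_eq_iff)
  moreover have "\<not> has_tail arev (arev e # map arev (rev r))"
    using nb e arev_neq[OF e]
    by (auto simp: has_backtracking_Cons has_tail_def last_map last_rev arev_eq_iff)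
  ultimately show ?thesis
    using e len by (auto simp: r geodesics_from_arc_def closed_geodesic_def)
qed

end

context regular_bidirected_graph
begin

lemma geodesics_from_arc_eq:
  "geodesics_from_arc e m =
     {p \<in> geodesics (tail G e) m (tail G e). p \<noteq> [] \<and> hd p = e \<and> last p \<noteq> bar e}"
  by (auto simp: geodesics_from_arc_def geodesics_def closed_geodesic_def has_tail_def)

lemma finite_from_arc:
  assumes "e \<in> arcs G"
  shows "finite (geodesics_from_arc e m)" "finite (tailed_from_arc e m)"
  using finite_geodesics[of "tail G e" m "tail G e"] assms
  by (auto simp: geodesics_from_arc_eq tailed_from_arc_def)

lemma card_geodesics_from_arc_le:
  assumes "e \<in> arcs G"
  shows "card (geodesics_from_arc e m) \<le> card (geodesics_from_arc (bar e) m)"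
proof (rule card_inj_on_le[where f = "\<lambda>p. bar e # map bar (rev (tl p))"])
  show "inj_on (\<lambda>p. bar e # map bar (rev (tl p))) (geodesics_from_arc e m)"
  proof (rule inj_onI)
    fix p r assume "p \<in> geodesics_from_arc e m" "r \<in> geodesics_from_arc e m"
      and eq: "bar e # map bar (rev (tl p)) = bar e # map bar (rev (tl r))"
    then have "p \<noteq> []" "r \<noteq> []" "hd p = hd r" by (auto simp: geodesics_from_arc_def)
    moreover have "tl p = tl r"
      using eq bij_is_inj[OF bij_arev] by (simp add: inj_map_eq_map)
    ultimately show "p = r" by (metis list.collapse)
  qed
qed (use assms rotate_reverse_geodesic finite_from_arc in auto)

lemma card_geodesics_from_arc_bar:
  assumes "e \<in> arcs G"
  shows "card (geodesics_from_arc (bar e) m) = card (geodesics_from_arc e m)"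
  using card_geodesics_from_arc_le[OF assms] card_geodesics_from_arc_le[of "bar e" m] assms
  by (intro antisym) auto

lemma card_tailed_extension:
  assumes e: "e \<in> arcs G" and n: "n > 0"
  shows "card (tailed_from_arc e (n + 2)) =
    card {p \<in> geodesics (head G e) n (head G e). hd p \<noteq> bar e \<and> last p \<noteq> e}"
proof -
  have "tailed_from_arc e (n + 2) = (\<lambda>p. e # p @ [bar e]) `
      {p \<in> geodesics (head G e) n (head G e). hd p \<noteq> bar e \<and> last p \<noteq> e}" (is "?L = ?f ` ?R")
  proof (intro equalityI subsetI)
    fix p assume p: "p \<in> ?L"
    then obtain r where r: "p = e # r" "r \<noteq> []" "last r = bar e"
      using n by (cases p) (auto simp: tailed_from_arc_def geodesics_def split: if_splits)
    then obtain s where s: "p = e # s @ [bar e]"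
      by (metis append_butlast_last_id)
    then have "s \<noteq> []" using p n by (auto simp: tailed_from_arc_def geodesics_def)
    have "awalk (head G e) (s @ [bar e]) (tail G e)"
      using p s by (auto simp: tailed_from_arc_def geodesics_def awalk_Cons_iff)
    then have "awalk (head G e) s (head G e)"
      using e by (auto simp: awalk_Cons_iff)
    then have "s \<in> ?R"
      using p \<open>s \<noteq> []\<close> unfolding s
      by (auto simp: tailed_from_arc_def geodesics_def has_backtracking_Cons has_backtracking_append)
    then show "p \<in> ?f ` ?R" using s by blast
  next
    fix p assume "p \<in> ?f ` ?R"
    then obtain s where s: "p = e # s @ [bar e]" "s \<in> ?R" by blast
    then have "s \<noteq> []" and w: "awalk (head G e) s (head G e)"
      using n by (auto simp: geodesics_def)
    have "awalk (head G e) (s @ [bar e]) (tail G e)"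
      by (rule awalk_appendI[OF w]) (use e in \<open>auto simp: awalk_Cons_iff awalk_Nil_iff\<close>)
    then show "p \<in> ?L"
      using s e \<open>s \<noteq> []\<close>
      by (auto simp: tailed_from_arc_def geodesics_def has_backtracking_Cons
          has_backtracking_append awalk_Cons_iff arev_eq_iff)
  qed
  moreover have "inj_on ?f ?R" by (auto simp: inj_on_def)
  ultimately show ?thesis by (simp add: card_image)
qed

text \<open>
  The closed paths without backtracking at the terminus of \<open>e\<close> are sorted by whether they start with the
  inverse of \<open>e\<close> and whether they end with \<open>e\<close>.  With neither, they are the paths that can be
  extended by \<open>e\<close> on both sides to a tailed path.  The two mixed classes are exchanged by
  reversal and consist of closed geodesics; with both, the path is tailed.
\<close>

lemma card_geodesics_by_ends:
  assumes e: "e \<in> arcs G" and n: "n > 0"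
  shows "card (geodesics (head G e) n (head G e)) =
    card (tailed_from_arc e (n + 2)) + 2 * card (geodesics_from_arc (bar e) n) +
    card (tailed_from_arc (bar e) n)"
proof -
  let ?h = "head G e"
  let ?C = "geodesics ?h n ?h"
  let ?A1 = "{p \<in> ?C. hd p \<noteq> bar e \<and> last p \<noteq> e}"
  let ?A2 = "{p \<in> ?C. hd p = bar e \<and> last p \<noteq> e}"
  let ?A3 = "{p \<in> ?C. hd p \<noteq> bar e \<and> last p = e}"
  let ?A4 = "{p \<in> ?C. hd p = bar e \<and> last p = e}"
  have fin: "finite ?C" using e by (simp add: finite_geodesics)
  have ne: "p \<noteq> []" if "p \<in> ?C" for p using that n by (auto simp: geodesics_def)
  have "?C = ((?A1 \<union> ?A2) \<union> ?A3) \<union> ?A4" by blast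
  then have "card ?C = card (((?A1 \<union> ?A2) \<union> ?A3) \<union> ?A4)" by simp
  also have "\<dots> = card ((?A1 \<union> ?A2) \<union> ?A3) + card ?A4"
    using fin by (intro card_Un_disjoint) auto
  also have "card ((?A1 \<union> ?A2) \<union> ?A3) = card (?A1 \<union> ?A2) + card ?A3"
    using fin by (intro card_Un_disjoint) auto
  also have "card (?A1 \<union> ?A2) = card ?A1 + card ?A2"
    using fin by (intro card_Un_disjoint) auto
  also have "card ?A3 = card ?A2"
  proof (rule bij_betw_same_card)
    let ?r = "\<lambda>p. map bar (rev p)"
    have r: "?r p \<in> ?C" if "p \<in> ?C" for p
      using that by (auto simp: geodesics_def awalk_reverse has_backtracking_reverse)
    show "bij_betw ?r ?A3 ?A2"
    proof (rule bij_betw_byWitness[where f' = ?r])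
      have ends: "hd (?r p) = bar (last p)" "last (?r p) = bar (hd p)" if "p \<in> ?C" for p
        using ne[OF that] by (auto simp: hd_map hd_rev last_map last_rev)
      have *: "bar a = b \<longleftrightarrow> a = bar b" for a b by (metis arev_arev)
      show "?r ` ?A3 \<subseteq> ?A2"
        using r ends by (auto simp: * simp del: rev_map)
      show "?r ` ?A2 \<subseteq> ?A3"
        using r ends by (auto simp: * simp del: rev_map)
    qed (simp_all only: reverse_reverse, simp_all)
  qed
  also have "?A2 = geodesics_from_arc (bar e) n"
    using e ne by (auto simp: geodesics_from_arc_eq)
  also have "?A4 = tailed_from_arc (bar e) n"
    using e ne by (auto simp: tailed_from_arc_def)
  finally show ?thesis using card_tailed_extension[OF assms] by simp
qed

lemma num_closed_geodesics_by_arc: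
  assumes x: "x \<in> verts G" and n: "n > 0"
  shows "num_closed_geodesics G bar x n = (\<Sum>e\<in>out_arcs G x. card (geodesics_from_arc e n))"
proof -
  have "{p. closed_geodesic G bar x p \<and> length p = n} = (\<Union>e\<in>out_arcs G x. geodesics_from_arc e n)"
  proof (intro equalityI subsetI)
    fix p assume p: "p \<in> {p. closed_geodesic G bar x p \<and> length p = n}"
    then have "p \<noteq> []" "hd p \<in> out_arcs G x"
      using n by (cases p; auto simp: closed_geodesic_def awalk_Cons_iff)+
    then show "p \<in> (\<Union>e\<in>out_arcs G x. geodesics_from_arc e n)"
      using p by (auto simp: geodesics_from_arc_def)
  qed (auto simp: geodesics_from_arc_def)
  then show ?thesis
    unfolding num_closed_geodesics_def
  proof (simp only:, intro card_UN_disjoint)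
    show "\<forall>e\<in>out_arcs G x. finite (geodesics_from_arc e n)"
      by (simp add: finite_from_arc)
  qed (auto simp: finite_out_arcs x geodesics_from_arc_def)
qed

lemma card_closed_geodesics_split:
  assumes x: "x \<in> verts G" and n: "n > 0"
  shows "card (geodesics x n x) =
    num_closed_geodesics G bar x n + (\<Sum>e\<in>out_arcs G x. card (tailed_from_arc e n))"
proof -
  let ?H = "{p. closed_geodesic G bar x p \<and> length p = n}"
  let ?T = "\<Union>e\<in>out_arcs G x. tailed_from_arc e n"
  have T: "?T = {p \<in> geodesics x n x. has_tail bar p}"
  proof (intro equalityI subsetI)
    fix p assume p: "p \<in> {p \<in> geodesics x n x. has_tail bar p}"
    then have "p \<noteq> []" "hd p \<in> out_arcs G x" "last p = bar (hd p)"
      using n by (cases p; auto simp: geodesics_def awalk_Cons_iff has_tail_def)+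
    then show "p \<in> ?T" using p by (auto simp: tailed_from_arc_def)
  qed (auto simp: tailed_from_arc_def has_tail_def)
  have "card (geodesics x n x) = card (?H \<union> ?T)"
    unfolding T by (intro arg_cong[where f = card]) (auto simp: geodesics_def closed_geodesic_def)
  also have "\<dots> = card ?H + card ?T"
  proof (rule card_Un_disjoint)
    show "finite ?H"
      by (rule finite_subset[OF _ finite_geodesics[OF x, of n x]])
         (auto simp: geodesics_def closed_geodesic_def)
    show "finite ?T" unfolding T using finite_geodesics[OF x, of n x] by simp
    show "?H \<inter> ?T = {}" unfolding T by (auto simp: closed_geodesic_def)
  qed
  also have "card ?T = (\<Sum>e\<in>out_arcs G x. card (tailed_from_arc e n))"
  proof (rule card_UN_disjoint)
    show "\<forall>e\<in>out_arcs G x. finite (tailed_from_arc e n)"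
      by (simp add: finite_from_arc)
  qed (auto simp: finite_out_arcs x tailed_from_arc_def)
  finally show ?thesis by (simp add: num_closed_geodesics_def)
qed

text \<open>
  The tailed paths through \<open>e\<close> and those through its inverse are based at different vertices, and in
  an infinite graph no double count over all vertices compares them.  They are equally many
  because \<open>card_geodesics_by_ends\<close>, applied to \<open>e\<close> and to its inverse, gives both counts the same
  recursion as soon as the number of closed paths without backtracking is the same at all vertices.
\<close>

lemma card_tailed_from_arc_bar:
  assumes hom: "\<And>n x y. x \<in> verts G \<Longrightarrow> y \<in> verts G \<Longrightarrow>
      card (geodesics x n x) = card (geodesics y n y)"
    and e: "e \<in> arcs G"
  shows "card (tailed_from_arc (bar e) n) = card (tailed_from_arc e n)"
proof (induction n rule: less_induct)
  case (less n)
  show ?case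
  proof (cases "n \<le> 2")
    case True
    then show ?thesis by (simp add: tailed_from_arc_small)
  next
    case False
    then have k: "n = (n - 2) + 2" "n - 2 > 0" by auto
    then obtain k where k: "n = k + 2" "k > 0" by blast
    have "card (geodesics (head G e) k (head G e)) = card (geodesics (tail G e) k (tail G e))"
      using e by (intro hom) auto
    moreover have "card (tailed_from_arc (bar e) k) = card (tailed_from_arc e k)"
      using k by (intro less) simp
    moreover note card_geodesics_by_ends[OF e k(2)] card_geodesics_from_arc_bar[OF e, of k]
    moreover have "card (geodesics (tail G e) k (tail G e)) = card (tailed_from_arc (bar e) (k + 2)) +
        2 * card (geodesics_from_arc e k) + card (tailed_from_arc e k)"
      using card_geodesics_by_ends[OF _ k(2), of "bar e"] e by simp
    ultimately show ?thesis unfolding k(1) by linarith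
  qed
qed

text \<open>
  Summing \<open>card_geodesics_by_ends\<close> over the edges \<open>e\<close> at \<open>x\<close> gives \<open>(q + 1) c_n\<close> on the left, where
  \<open>c_n\<close> counts closed paths without backtracking.  By the symmetry under inversion of \<open>e\<close> all terms
  on the right become counts at \<open>x\<close>, and the tailed paths there number \<open>c_n - N_n\<close>.
\<close>

lemma closed_geodesic_recurrence:
  assumes hom: "\<And>n x y. x \<in> verts G \<Longrightarrow> y \<in> verts G \<Longrightarrow>
      card (geodesics x n x) = card (geodesics y n y)"
    and x: "x \<in> verts G" and n: "n > 0"
  shows "card (geodesics x (n + 2) x) + num_closed_geodesics G bar x n =
    num_closed_geodesics G bar x (n + 2) + q * card (geodesics x n x)"
proof -
  let ?O = "out_arcs G x"
  have "(q + 1) * card (geodesics x n x) = (\<Sum>e\<in>?O. card (geodesics (head G e) n (head G e)))"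
  proof -
    have "card (geodesics (head G e) n (head G e)) = card (geodesics x n x)" if "e \<in> ?O" for e
      using hom[of "head G e" x n] that x by simp
    then show ?thesis by (simp add: card_out_arcs[OF x])
  qed
  also have "\<dots> = (\<Sum>e\<in>?O. card (tailed_from_arc e (n + 2)) + 2 * card (geodesics_from_arc e n) +
      card (tailed_from_arc e n))"
    by (intro sum.cong refl)
       (simp add: card_geodesics_by_ends n card_geodesics_from_arc_bar card_tailed_from_arc_bar[OF hom])
  also have "\<dots> = (\<Sum>e\<in>?O. card (tailed_from_arc e (n + 2))) +
      2 * num_closed_geodesics G bar x n + (\<Sum>e\<in>?O. card (tailed_from_arc e n))"
    by (simp add: sum.distrib sum_distrib_left num_closed_geodesics_by_arc x n)
  finally show ?thesis
    using card_closed_geodesics_split[OF x n] card_closed_geodesics_split[OF x, of "n + 2"]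
    by (simp add: algebra_simps)
qed

lemma card_geodesics_small:
  assumes x: "x \<in> verts G" and n: "n = 1 \<or> n = 2"
  shows "card (geodesics x n x) = num_closed_geodesics G bar x n"
  using card_closed_geodesics_split[OF x, of n] n by (auto simp: tailed_from_arc_small)

text \<open>
  Removing tails from a closed path without backtracking leaves a nonempty path, since the two
  edges of a tail are not adjacent; hence repeated removal ends with a closed geodesic of positive
  length.
\<close>

lemma card_geodesics_tree:
  assumes nogeo: "\<And>x p. closed_geodesic G bar x p \<Longrightarrow> p = []"
    and x: "x \<in> verts G" and n: "n > 0"
  shows "card (geodesics x n x) = 0"
  using n x
proof (induction n arbitrary: x rule: less_induct)
  case (less n)
  have "card (tailed_from_arc e n) = 0" if e: "e \<in> out_arcs G x" for e
  proof (cases "n \<le> 2")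
    case False
    then have k: "n = (n - 2) + 2" "n - 2 > 0" by auto
    then obtain k where k: "n = k + 2" "k > 0" by blast
    then show ?thesis
      using card_geodesics_by_ends[of e k] less.IH[of k "head G e"] e by auto
  qed (simp add: tailed_from_arc_small)
  moreover have "num_closed_geodesics G bar x n = 0"
  proof -
    have "{p. closed_geodesic G bar x p \<and> length p = n} = {}"
      using nogeo[of x] less.prems(1) by force
    then show ?thesis by (simp only: num_closed_geodesics_def card.empty)
  qed
  ultimately show ?case
    using card_closed_geodesics_split less.prems by simp
qed

lemma card_geodesics_automorphism_le:
  assumes aut: "(\<phi>, \<psi>) \<in> graph_automorphisms G bar" and x: "x \<in> verts G"
  shows "card (geodesics x n x) \<le> card (geodesics (\<phi> x) n (\<phi> x))"
proof (rule card_inj_on_le[where f = "map \<psi>"])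
  have bij: "bij_betw \<phi> (verts G) (verts G)" "bij_betw \<psi> (arcs G) (arcs G)"
    and hom: "\<And>e. e \<in> arcs G \<Longrightarrow> tail G (\<psi> e) = \<phi> (tail G e) \<and> head G (\<psi> e) = \<phi> (head G e) \<and>
                 \<psi> (bar e) = bar (\<psi> e)"
    using aut by (auto simp: graph_automorphisms_def BijGroup_def Bij_def)
  have inj: "inj_on \<psi> (arcs G)" using bij by (simp add: bij_betw_def)
  have arcs: "set p \<subseteq> arcs G" if "p \<in> geodesics x n x" for p
    using that by (auto simp: geodesics_def awalk_def)
  show "inj_on (map \<psi>) (geodesics x n x)"
    by (rule inj_on_mapI) (use arcs inj in \<open>blast intro: inj_on_subset\<close>)
  show "finite (geodesics (\<phi> x) n (\<phi> x))"
    using bij x by (intro finite_geodesics) (auto dest: bij_betwE)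
  have walk: "awalk (\<phi> u) (map \<psi> p) (\<phi> v)" if "awalk u p v" for u p v
    using that
  proof (induction p arbitrary: u)
    case Nil
    then show ?case using bij by (auto simp: awalk_Nil_iff dest: bij_betwE)
  next
    case (Cons e p)
    then show ?case using bij hom by (auto simp: awalk_Cons_iff dest: bij_betwE)
  qed
  show "map \<psi> ` geodesics x n x \<subseteq> geodesics (\<phi> x) n (\<phi> x)"
  proof safe
    fix p assume p: "p \<in> geodesics x n x"
    have "has_backtracking bar (map \<psi> p) \<longleftrightarrow> has_backtracking bar p"
      by (rule has_backtracking_map[OF arcs[OF p] inj]) (use hom in auto)
    then show "map \<psi> p \<in> geodesics (\<phi> x) n (\<phi> x)"
      using p walk by (auto simp: geodesics_def)
  qed
qed

lemma card_geodesics_vertex_transitive: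
  assumes "vertex_transitive G bar" "x \<in> verts G" "y \<in> verts G"
  shows "card (geodesics x n x) = card (geodesics y n y)"
proof -
  have le: "card (geodesics u n u) \<le> card (geodesics v n v)"
    if uv: "u \<in> verts G" "v \<in> verts G" for u v
  proof -
    obtain \<Gamma> where \<Gamma>: "\<Gamma> \<subseteq> graph_automorphisms G bar"
      "transitive_action ((vert_arc_bij_group G)\<lparr>carrier := \<Gamma>\<rparr>) (verts G) fst"
      using assms(1) unfolding vertex_transitive_def by blast
    then obtain g where "g \<in> \<Gamma>" "fst g u = v"
      using transitive_action.unique_orbit[OF \<Gamma>(2) uv] by auto
    then show ?thesis
      using card_geodesics_automorphism_le[of "fst g" "snd g" u n] \<Gamma>(1) uv by auto
  qed
  then show ?thesis using assms by (intro antisym)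
qed

end

section \<open>From walk weights to binomial coefficients\<close>

text \<open>
  For \<open>n = m + 2 j\<close> this is \<open>(n choose j) q^j\<close>, which is \<open>n!\<close> times the coefficient of \<open>t^n\<close> in
  \<open>q^(-m/2) I_m(2 sqrt q t)\<close>.
\<close>

definition bessel_weight :: "nat \<Rightarrow> nat \<Rightarrow> nat \<Rightarrow> nat" where
  "bessel_weight q n m =
     (if m \<le> n \<and> even (n - m) then (n choose ((n - m) div 2)) * q ^ ((n - m) div 2) else 0)"

lemma bessel_weight_add: "bessel_weight q (m + 2 * j) m = ((m + 2 * j) choose j) * q ^ j"
  by (simp add: bessel_weight_def)

lemma bessel_weight_eq_0: "n \<notin> range (\<lambda>j. m + 2 * j) \<Longrightarrow> bessel_weight q n m = 0"
proof (rule ccontr)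
  assume n: "n \<notin> range (\<lambda>j. m + 2 * j)" and "bessel_weight q n m \<noteq> 0"
  then have "m \<le> n" "even (n - m)" by (auto simp: bessel_weight_def split: if_splits)
  then have "n = m + 2 * ((n - m) div 2)" by simp
  then show False using n by blast
qed

lemma bessel_weight_Suc_Suc:
  "bessel_weight q (Suc n) (Suc m) = bessel_weight q n m + q * bessel_weight q n (m + 2)"
proof (cases "n \<in> range (\<lambda>j. m + 2 * j)")
  case True
  then obtain j where j: "n = m + 2 * j" by blast
  have l: "bessel_weight q (Suc n) (Suc m) = (Suc n choose j) * q ^ j"
    using bessel_weight_add[of q "Suc m" j] by (simp add: j)
  show ?thesis
  proof (cases j)
    case 0
    then show ?thesis using l by (simp add: j bessel_weight_def)
  next
    case (Suc i)
    then have "n = (m + 2) + 2 * i" using j by simp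
    then have "bessel_weight q n (m + 2) = (n choose i) * q ^ i"
      by (simp only: bessel_weight_add)
    moreover have "bessel_weight q n m = (n choose j) * q ^ j"
      using bessel_weight_add[of q m j] by (simp only: j)
    ultimately show ?thesis
      using l by (simp add: Suc algebra_simps)
  qed
next
  case False
  then have "Suc n \<notin> range (\<lambda>j. Suc m + 2 * j)" "n \<notin> range (\<lambda>j. (m + 2) + 2 * j)"
    by (auto simp: image_iff dest: spec[of _ "Suc _"])
  then have "bessel_weight q (Suc n) (Suc m) = 0" "bessel_weight q n (m + 2) = 0"
    by (blast intro: bessel_weight_eq_0)+
  moreover have "bessel_weight q n m = 0" using False by (rule bessel_weight_eq_0)
  ultimately show ?thesis by simp
qed

text \<open>
  At \<open>m = 0\<close> the recursion of \<open>bessel_weight_Suc_Suc\<close> would involve order \<open>-1\<close>; by the symmetry of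
  the binomial coefficients the weight of order \<open>-1\<close> is \<open>q\<close> times that of order \<open>1\<close>.
\<close>

lemma bessel_weight_Suc_0: "bessel_weight q (Suc n) 0 = 2 * q * bessel_weight q n 1"
proof (cases "n \<in> range (\<lambda>j. 1 + 2 * j)")
  case True
  then obtain j where j: "n = 1 + 2 * j" by blast
  have "bessel_weight q (Suc n) 0 = (2 * Suc j choose Suc j) * q ^ Suc j"
    using bessel_weight_add[of q 0 "Suc j"] by (simp add: j)
  also have "2 * Suc j choose Suc j = (n choose Suc j) + (n choose j)"
    by (simp add: j)
  also have "n choose Suc j = n choose j"
    using binomial_symmetric[of "Suc j" n] by (simp add: j)
  finally show ?thesis
    using bessel_weight_add[of q 1 j] by (simp add: j)
next
  case False
  then have "Suc n \<notin> range (\<lambda>j. 0 + 2 * j)"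
    by (auto simp: image_iff) presburger
  then have "bessel_weight q (Suc n) 0 = 0" by (rule bessel_weight_eq_0)
  moreover have "bessel_weight q n 1 = 0" using False by (rule bessel_weight_eq_0)
  ultimately show ?thesis by simp
qed

text \<open>
  With \<open>w\<close> and \<open>B\<close> for the two weights, this says \<open>w_m - w_{m+2} = B_m - q B_{m+2}\<close>.  For \<open>m > 0\<close> both
  weights obey the same recursion in \<open>n\<close>; the combination is the one for which the different
  boundary rules at \<open>m = 0\<close> agree as well: each side at \<open>(n + 1, 0)\<close> is \<open>q\<close> times its value at \<open>(n, 1)\<close>.
\<close>

lemma walk_weight_bessel_weight:
  "walk_weight q n m + q * bessel_weight q n (m + 2) =
   walk_weight q n (m + 2) + bessel_weight q n m"
proof (induction n arbitrary: m)
  case 0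
  then show ?case by (auto simp: bessel_weight_def)
next
  case (Suc n)
  show ?case
  proof (cases m)
    case 0
    have "q * (walk_weight q n 1 + q * bessel_weight q n 3) =
          q * (walk_weight q n 3 + bessel_weight q n 1)"
      using Suc.IH[of 1] by (simp add: numeral_3_eq_3)
    moreover have "bessel_weight q (Suc n) 2 = bessel_weight q n 1 + q * bessel_weight q n 3"
      using bessel_weight_Suc_Suc[of q n 1] by (simp add: numeral_2_eq_2 numeral_3_eq_3)
    moreover have "walk_weight q (Suc n) 2 = walk_weight q n 1 + q * walk_weight q n 3"
      using walk_weight.simps(3)[of q n 1] by (simp add: numeral_2_eq_2 numeral_3_eq_3)
    ultimately show ?thesis
      using bessel_weight_Suc_0[of q n] by (simp add: 0 algebra_simps eval_nat_numeral)
  next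
    case (Suc k)
    have "q * (walk_weight q n (k + 2) + q * bessel_weight q n (k + 4)) =
          q * (walk_weight q n (k + 4) + bessel_weight q n (k + 2))"
      using Suc.IH[of "k + 2"] by (simp add: eval_nat_numeral)
    moreover have "bessel_weight q (Suc n) (k + 3) = bessel_weight q n (k + 2) + q * bessel_weight q n (k + 4)"
      using bessel_weight_Suc_Suc[of q n "k + 2"] by (simp add: eval_nat_numeral)
    moreover have "walk_weight q (Suc n) (k + 3) = walk_weight q n (k + 2) + q * walk_weight q n (k + 4)"
      using walk_weight.simps(3)[of q n "k + 2"] by (simp add: eval_nat_numeral)
    moreover have "m + 2 = k + 3" using Suc by simp
    ultimately show ?thesis
      using bessel_weight_Suc_Suc[of q n k] Suc.IH[of k]
      by (simp add: Suc algebra_simps eval_nat_numeral)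
  qed
qed

lemma bessel_weight_le: "bessel_weight q n m \<le> (q + 1) ^ n"
proof -
  have "(n choose j) * q ^ j \<le> (q + 1) ^ n" if "j \<le> n" for j
  proof -
    have "(n choose j) * q ^ j \<le> (\<Sum>k\<le>n. (n choose k) * q ^ k)"
      using that by (intro member_le_sum[where f = "\<lambda>k. (n choose k) * q ^ k"]) auto
    then show ?thesis using binomial_ring[of q 1 n] by simp
  qed
  then show ?thesis by (auto simp: bessel_weight_def)
qed

lemma sum_by_parts_step_2:
  fixes w f c :: "nat \<Rightarrow> real"
  assumes w: "\<And>m. n < m \<Longrightarrow> w m = 0"
    and f0: "f 0 = 0" and c1: "c 1 = f 1" and c: "\<And>m. c (m + 2) = f (m + 2) - r * f m"
  shows "(\<Sum>m=1..n. w m * c m) = (\<Sum>m\<le>n. (w m - r * w (m + 2)) * f m)"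
proof -
  have shift: "(\<Sum>m\<le>n. w (m + 2) * g (m + 2)) = (\<Sum>m\<le>n. w m * g m) - w 0 * g 0 - w 1 * g 1"
    for g :: "nat \<Rightarrow> real"
  proof -
    have "(\<Sum>m\<le>n. w m * g m) = (\<Sum>m\<le>Suc (Suc n). w m * g m)"
      by (simp add: w)
    also have "\<dots> = w 0 * g 0 + w 1 * g 1 + (\<Sum>m\<le>n. w (m + 2) * g (m + 2))"
      by (simp only: sum.atMost_Suc_shift) simp
    finally show ?thesis by simp
  qed
  have "(\<Sum>m=1..n. w m * c m) = (\<Sum>m\<le>n. w m * c m) - w 0 * c 0"
    by (simp add: atMost_atLeast0 sum.atLeast_Suc_atMost)
  also have "\<dots> = w 1 * f 1 + (\<Sum>m\<le>n. w (m + 2) * c (m + 2))"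
    using shift[of c] c1 by simp
  also have "\<dots> = w 1 * f 1 + (\<Sum>m\<le>n. w (m + 2) * f (m + 2)) - (\<Sum>m\<le>n. r * w (m + 2) * f m)"
    by (simp add: c[simplified] algebra_simps sum_subtractf)
  also have "\<dots> = (\<Sum>m\<le>n. w m * f m) - (\<Sum>m\<le>n. r * w (m + 2) * f m)"
    using shift[of f] f0 by simp
  finally show ?thesis by (simp add: algebra_simps sum_subtractf)
qed

text \<open>For \<open>m > 0\<close> this is the sum \<open>c m + c (m - 2) + c (m - 4) + \<dots>\<close> over positive indices.\<close>

fun sum_step_2 :: "(nat \<Rightarrow> real) \<Rightarrow> nat \<Rightarrow> real" where
  "sum_step_2 c 0 = 0"
| "sum_step_2 c (Suc 0) = c 1"
| "sum_step_2 c (Suc (Suc m)) = c (Suc (Suc m)) + sum_step_2 c m"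

text \<open>
  The recurrence between \<open>c\<close> and \<open>N\<close> is solved by \<open>c_m = f_m - f_{m-2}\<close> and \<open>N_m = f_m - q f_{m-2}\<close>,
  where \<open>f\<close> is the step-two partial sum of \<open>c\<close>.  Summation by parts moves both differences to the
  weights, where \<open>walk_weight_bessel_weight\<close> identifies them.
\<close>

lemma sum_walk_weight_eq_sum_bessel_weight:
  fixes c N :: "nat \<Rightarrow> nat"
  assumes small: "c 1 = N 1" "c 2 = N 2"
    and rec: "\<And>m. m > 0 \<Longrightarrow> c (m + 2) + N m = N (m + 2) + q * c m"
  shows "(\<Sum>m=1..n. walk_weight q n m * c m) = (\<Sum>m=1..n. bessel_weight q n m * N m)"
proof -
  let ?f = "sum_step_2 (\<lambda>m. real (c m))"
  have c: "real (c 1) = ?f 1" "real (c (m + 2)) = ?f (m + 2) - 1 * ?f m" for m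
    by simp_all
  have N: "real (N (m + 2)) = ?f (m + 2) - real q * ?f m" for m
  proof (induction m rule: less_induct)
    case (less m)
    show ?case
    proof (cases "m = 0")
      case True
      then show ?thesis using small by (simp add: numeral_2_eq_2)
    next
      case False
      have IH: "real (N m) = ?f m - real q * (if m = 1 then 0 else ?f (m - 2))"
      proof (cases "m = 1")
        case False
        then have "m = (m - 2) + 2" using \<open>m \<noteq> 0\<close> by simp
        then obtain k where "m = k + 2" by blast
        then show ?thesis using less.IH[of k] by simp
      qed (use small in simp)
      have "?f m = real (c m) + (if m = 1 then 0 else ?f (m - 2))"
      proof (cases "m = 1")
        case False
        then have "m = Suc (Suc (m - 2))" using \<open>m \<noteq> 0\<close> by simp
        then obtain k where "m = Suc (Suc k)" by blast
        then show ?thesis by simp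
      qed simp
      moreover have "real (c (m + 2)) + real (N m) = real (N (m + 2)) + real q * real (c m)"
        using rec[of m] False by (simp flip: of_nat_add of_nat_mult)
      ultimately show ?thesis
        using IH by (simp add: algebra_simps)
    qed
  qed
  have "(\<Sum>m=1..n. real (walk_weight q n m) * real (c m)) =
      (\<Sum>m\<le>n. (real (walk_weight q n m) - 1 * real (walk_weight q n (m + 2))) * ?f m)"
    by (rule sum_by_parts_step_2) (use c in \<open>simp_all add: walk_weight_eq_0\<close>)
  also have "\<dots> = (\<Sum>m\<le>n. (real (bessel_weight q n m) - real q * real (bessel_weight q n (m + 2))) * ?f m)"
  proof (intro sum.cong refl)
    fix m
    have "real (walk_weight q n m) - 1 * real (walk_weight q n (m + 2)) =
        real (bessel_weight q n m) - real q * real (bessel_weight q n (m + 2))"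
      using arg_cong[OF walk_weight_bessel_weight[of q n m], of real] by simp
    then show "(real (walk_weight q n m) - 1 * real (walk_weight q n (m + 2))) * ?f m =
        (real (bessel_weight q n m) - real q * real (bessel_weight q n (m + 2))) * ?f m"
      by simp
  qed
  also have "\<dots> = (\<Sum>m=1..n. real (bessel_weight q n m) * real (N m))"
    by (rule sum_by_parts_step_2[symmetric]) (use N small in \<open>simp_all add: bessel_weight_def\<close>)
  finally have "real (\<Sum>m=1..n. walk_weight q n m * c m) = real (\<Sum>m=1..n. bessel_weight q n m * N m)"
    by simp
  then show ?thesis by (simp only: of_nat_eq_iff)
qed

section \<open>The heat kernel as a walk series\<close>

lemma exp_sums_real: "(\<lambda>n. y ^ n / fact n) sums exp (y :: real)"
  using exp_converges[of y] by (simp add: field_simps)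

lemma summable_exponential_bound:
  fixes a :: "nat \<Rightarrow> real"
  assumes "\<And>n. \<bar>a n\<bar> \<le> K ^ n"
  shows "summable (\<lambda>n. a n / fact n * t ^ n)"
proof (rule summable_comparison_test')
  show "summable (\<lambda>n. (K * \<bar>t\<bar>) ^ n / fact n)"
    using exp_sums_real by (rule sums_summable)
  show "norm (a n / fact n * t ^ n) \<le> (K * \<bar>t\<bar>) ^ n / fact n" if "n \<ge> 0" for n
    using mult_right_mono[OF assms[of n], of "\<bar>t\<bar> ^ n"]
    by (simp add: abs_mult power_abs power_mult_distrib divide_right_mono)
qed

context regular_bidirected_graph
begin

text \<open>The kernel of \<open>exp (t A)\<close> for the adjacency operator \<open>A\<close>.\<close>

definition walk_series :: "'v \<Rightarrow> 'v \<Rightarrow> real \<Rightarrow> real" where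
  "walk_series x y t = (\<Sum>n. real (num_walks n x y) / fact n * t ^ n)"

lemma num_walks_le_real: "x \<in> verts G \<Longrightarrow> real (num_walks n x y) \<le> (real q + 1) ^ n"
  using num_walks_le[of x n y] by (simp flip: of_nat_Suc of_nat_power add: of_nat_le_iff add.commute)

lemma summable_walk_series:
  "x \<in> verts G \<Longrightarrow> summable (\<lambda>n. real (num_walks n x y) / fact n * t ^ n)"
  by (rule summable_exponential_bound[where K = "real q + 1"]) (simp add: num_walks_le_real)

lemma walk_series_0: "walk_series x y 0 = (if x = y then 1 else 0)"
  unfolding walk_series_def by (subst powser_zero) simp

lemma walk_series_bounds:
  assumes x: "x \<in> verts G" and t: "t \<ge> 0"
  shows "0 \<le> walk_series x y t" "walk_series x y t \<le> exp ((real q + 1) * t)"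
proof -
  show "0 \<le> walk_series x y t"
    unfolding walk_series_def using t by (intro suminf_nonneg summable_walk_series x) simp
  have "walk_series x y t \<le> (\<Sum>n. ((real q + 1) * t) ^ n / fact n)"
    unfolding walk_series_def
  proof (intro suminf_le summable_walk_series x)
    show "real (num_walks n x y) / fact n * t ^ n \<le> ((real q + 1) * t) ^ n / fact n" for n
      using mult_right_mono[OF num_walks_le_real[OF x, of n y], of "t ^ n"] t
      by (simp add: power_mult_distrib divide_right_mono)
  qed (use exp_sums_real in \<open>rule sums_summable\<close>)
  also have "\<dots> = exp ((real q + 1) * t)"
    using exp_sums_real by (rule sums_unique[symmetric])
  finally show "walk_series x y t \<le> exp ((real q + 1) * t)" .
qed

lemma DERIV_walk_series:
  assumes x: "x \<in> verts G"
  shows "(walk_series x y has_real_derivative (\<Sum>e\<in>out_arcs G x. walk_series (head G e) y t)) (at t)"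
proof -
  let ?c = "\<lambda>n. real (num_walks n x y) / fact n"
  have "((\<lambda>t. \<Sum>n. ?c n * t ^ n) has_real_derivative (\<Sum>n. diffs ?c n * t ^ n)) (at t)"
    by (rule termdiffs_strong_converges_everywhere) (rule summable_walk_series[OF x])
  moreover have "diffs ?c n * t ^ n = (\<Sum>e\<in>out_arcs G x. real (num_walks n (head G e) y) / fact n * t ^ n)"
    for n
  proof -
    have "diffs ?c n = real (num_walks (Suc n) x y) / fact n"
      by (simp add: diffs_def del: of_nat_Suc num_walks.simps)
    then show ?thesis by (simp add: sum_divide_distrib sum_distrib_right)
  qed
  moreover have "(\<Sum>n. \<Sum>e\<in>out_arcs G x. real (num_walks n (head G e) y) / fact n * t ^ n) =
      (\<Sum>e\<in>out_arcs G x. walk_series (head G e) y t)"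
    unfolding walk_series_def by (rule suminf_sum) (rule summable_walk_series, simp)
  ultimately show ?thesis
    unfolding walk_series_def by simp
qed

lemma abs_laplacian_le:
  assumes x: "x \<in> verts G" and f: "\<And>z. z \<in> verts G \<Longrightarrow> \<bar>f z\<bar> \<le> K"
  shows "\<bar>laplacian q G f x\<bar> \<le> 2 * (real q + 1) * K"
proof -
  have "\<bar>\<Sum>e\<in>out_arcs G x. f (head G e)\<bar> \<le> (\<Sum>e\<in>out_arcs G x. K)"
    by (rule order_trans[OF sum_abs sum_mono]) (simp add: f)
  moreover have "\<bar>(real q + 1) * f x\<bar> \<le> (real q + 1) * K"
    using f[OF x] by (simp add: abs_mult)
  ultimately show ?thesis
    unfolding laplacian_def by (simp add: card_out_arcs[OF x] algebra_simps)
qed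

lemma laplacian_diff:
  "laplacian q G (\<lambda>x. u x - v x) x = laplacian q G u x - laplacian q G v x"
  by (simp add: laplacian_def sum_subtractf algebra_simps)

text \<open>
  The Laplacian multiplies a uniform bound by at most \<open>M = 2 (q + 1)\<close>.  Inserting a bound for \<open>w\<close> into
  the equation and integrating in time improves it, so that induction gives
  \<open>\<bar>w t x\<bar> \<le> C (M t)^n / n!\<close> for every \<open>n\<close>, and the right-hand side tends to \<open>0\<close>.
\<close>

lemma heat_equation_zero_initial:
  assumes bound: "\<And>t x. t \<ge> 0 \<Longrightarrow> x \<in> verts G \<Longrightarrow> \<bar>w t x\<bar> \<le> C"
    and deriv: "\<And>t x. t \<ge> 0 \<Longrightarrow> x \<in> verts G \<Longrightarrow>
      ((\<lambda>s. w s x) has_real_derivative - laplacian q G (w t) x) (at t within {0..})"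
    and init: "\<And>x. x \<in> verts G \<Longrightarrow> w 0 x = 0"
    and t: "t \<ge> 0" and x: "x \<in> verts G"
  shows "w t x = 0"
proof -
  define M where "M = 2 * (real q + 1)"
  have M: "M > 0" by (simp add: M_def)
  have iter: "\<bar>w t x\<bar> \<le> C * ((M * t) ^ n / fact n)" if "t \<ge> 0" "x \<in> verts G" for n t x
    using that
  proof (induction n arbitrary: t x)
    case 0
    then show ?case using bound by simp
  next
    case (Suc n)
    let ?g = "\<lambda>s. C * ((M * s) ^ Suc n / fact (Suc n))"
    have g: "(?g has_real_derivative M * (C * ((M * s) ^ n / fact n))) (at s)" for s
    proof -
      have "((*) M has_real_derivative M) (at s)"
        using DERIV_cmult_Id by blast
      from DERIV_power_Suc[OF this, of n]
      have "((\<lambda>s. (M * s) ^ Suc n) has_real_derivative real (Suc n) * (M * s) ^ n * M) (at s)"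
        by (simp add: mult_ac)
      then have "(?g has_real_derivative C * (real (Suc n) * (M * s) ^ n * M / fact (Suc n))) (at s)"
        by (intro DERIV_cmult DERIV_cdivide)
      moreover have "C * (real (Suc n) * (M * s) ^ n * M / fact (Suc n)) =
          M * (C * ((M * s) ^ n / fact n))"
        by (simp add: fact_Suc del: of_nat_Suc)
      ultimately show ?thesis by (simp only:)
    qed
    have cont: "continuous_on {0..t} (\<lambda>s. w s x)"
      using deriv[OF _ Suc.prems(2)]
      by (intro continuous_on_subset[where s = "{0..}", OF DERIV_continuous_on]) auto
    have contg: "continuous_on {0..t} ?g"
      by (intro continuous_intros) auto
    have lap: "\<bar>laplacian q G (w s) x\<bar> \<le> M * (C * ((M * s) ^ n / fact n))" if "s > 0" for s
      unfolding M_def by (rule abs_laplacian_le[OF Suc.prems(2)])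
        (use that Suc.IH in \<open>auto simp: M_def\<close>)
    have d: "((\<lambda>s. w s x) has_real_derivative - laplacian q G (w s) x) (at s)" if "s > 0" for s
    proof -
      have "at s within {0..} = at s"
        using that by (intro at_within_interior) (simp add: interior_real_atLeast)
      then show ?thesis using deriv[of s x] that Suc.prems by simp
    qed
    \<comment> \<open>The bound \<open>?g\<close> grows at least as fast as \<open>w\<close> and \<open>-w\<close>, so both differences are monotone.\<close>
    have "?g 0 - w 0 x \<le> ?g t - w t x"
    proof (rule DERIV_nonneg_imp_increasing_open[OF Suc.prems(1)])
      fix s :: real assume s: "0 < s"
      show "\<exists>y. ((\<lambda>s. ?g s - w s x) has_real_derivative y) (at s) \<and> 0 \<le> y"
        using DERIV_diff[OF g d[OF s]] lap[OF s] by (intro exI conjI) (assumption, linarith)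
    qed (intro continuous_on_diff cont contg)
    moreover have "?g 0 + w 0 x \<le> ?g t + w t x"
    proof (rule DERIV_nonneg_imp_increasing_open[OF Suc.prems(1)])
      fix s :: real assume s: "0 < s"
      show "\<exists>y. ((\<lambda>s. ?g s + w s x) has_real_derivative y) (at s) \<and> 0 \<le> y"
        using DERIV_add[OF g d[OF s]] lap[OF s] by (intro exI conjI) (assumption, linarith)
    qed (intro continuous_on_add cont contg)
    ultimately show ?case using init[OF Suc.prems(2)] by simp
  qed
  have "(\<lambda>n. C * ((M * t) ^ n / fact n)) \<longlonglongrightarrow> C * 0"
    by (intro tendsto_mult tendsto_const summable_LIMSEQ_zero sums_summable[OF exp_sums_real])
  then have "\<bar>w t x\<bar> \<le> C * 0"
    by (rule LIMSEQ_le_const) (intro exI allI impI, rule iter[OF t x])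
  then show ?thesis by simp
qed

lemma bounded_heat_solution_unique:
  assumes u: "bounded_heat_solution q G x0 u" and v: "bounded_heat_solution q G x0 v"
    and "t \<ge> 0" "x \<in> verts G"
  shows "u t x = v t x"
proof -
  obtain C1 C2 where C: "\<And>t x. t \<ge> 0 \<Longrightarrow> x \<in> verts G \<Longrightarrow> \<bar>u t x\<bar> \<le> C1"
    "\<And>t x. t \<ge> 0 \<Longrightarrow> x \<in> verts G \<Longrightarrow> \<bar>v t x\<bar> \<le> C2"
    using u v unfolding bounded_heat_solution_def by meson
  have deriv: "((\<lambda>s. u s x) has_real_derivative - laplacian q G (u t) x) (at t within {0..})"
    if u: "bounded_heat_solution q G x0 u" and tx: "t \<ge> 0" "x \<in> verts G" for u t x
  proof -
    obtain D where D: "((\<lambda>s. u s x) has_real_derivative D) (at t within {0..})"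
      "laplacian q G (u t) x + D = 0"
      using u tx unfolding bounded_heat_solution_def by meson
    then have "D = - laplacian q G (u t) x" by linarith
    with D(1) show ?thesis by simp
  qed
  have "(\<lambda>t x. u t x - v t x) t x = 0"
  proof (rule heat_equation_zero_initial[OF _ _ _ assms(3,4)])
    show "\<bar>u t x - v t x\<bar> \<le> C1 + C2" if "t \<ge> 0" "x \<in> verts G" for t x
      using C[OF that] by linarith
    show "((\<lambda>s. u s x - v s x) has_real_derivative - laplacian q G (\<lambda>x. u t x - v t x) x)
        (at t within {0..})" if "t \<ge> 0" "x \<in> verts G" for t x
      using DERIV_diff[OF deriv[OF u that] deriv[OF v that]] by (simp add: laplacian_diff)
    show "u 0 x - v 0 x = 0" if "x \<in> verts G" for x
      using u v that by (simp add: bounded_heat_solution_def)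
  qed
  then show ?thesis by simp
qed

lemma heat_kernel_eq_walk_series:
  assumes t: "t \<ge> 0" and x: "x \<in> verts G"
  shows "heat_kernel q G t x0 x = exp (- (real q + 1) * t) * walk_series x x0 t"
proof -
  define k where "k s y = (if s < 0 \<or> y \<notin> verts G then 0
    else exp (- (real q + 1) * s) * walk_series y x0 s)" for s y
  have sol: "bounded_heat_solution q G x0 k"
    unfolding bounded_heat_solution_def
  proof (intro conjI ballI allI impI)
    have "\<bar>k s y\<bar> \<le> 1" if "s \<ge> 0" "y \<in> verts G" for s y
    proof -
      have "exp (- (real q + 1) * s) * walk_series y x0 s \<le>
          exp (- (real q + 1) * s) * exp ((real q + 1) * s)"
        using that by (intro mult_left_mono walk_series_bounds) auto
      also have "\<dots> = 1" by (subst exp_add[symmetric]) (simp add: algebra_simps)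
      finally show ?thesis
        using walk_series_bounds(1)[of y s x0] that by (simp add: k_def)
    qed
    then show "\<exists>C. \<forall>s\<ge>0. \<forall>y\<in>verts G. \<bar>k s y\<bar> \<le> C" by blast
  next
    fix s :: real and y assume s: "s \<ge> 0" and y: "y \<in> verts G"
    let ?D = "exp (- (real q + 1) * s) * (\<Sum>e\<in>out_arcs G y. walk_series (head G e) x0 s) +
      exp (- (real q + 1) * s) * - (real q + 1) * walk_series y x0 s"
    have "((\<lambda>s. exp (- (real q + 1) * s)) has_real_derivative
        exp (- (real q + 1) * s) * - (real q + 1)) (at s)"
      by (rule DERIV_fun_exp[OF DERIV_cmult_Id])
    from DERIV_mult'[OF this DERIV_walk_series[OF y]]
    have "((\<lambda>s. exp (- (real q + 1) * s) * walk_series y x0 s) has_real_derivative ?D)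
        (at s within {0..})"
      by (rule has_field_derivative_at_within)
    then have "((\<lambda>s. k s y) has_real_derivative ?D) (at s within {0..})"
    proof (rule has_field_derivative_transform_within[where d = 1])
      show "exp (- (real q + 1) * r) * walk_series y x0 r = k r y" if "r \<in> {0..}" for r
        using that y by (simp add: k_def)
    qed (use s in simp_all)
    moreover have "laplacian q G (k s) y + ?D = 0"
    proof -
      have "(\<Sum>e\<in>out_arcs G y. k s (head G e)) =
          exp (- (real q + 1) * s) * (\<Sum>e\<in>out_arcs G y. walk_series (head G e) x0 s)"
        unfolding sum_distrib_left using s by (intro sum.cong refl) (simp add: k_def)
      moreover have "k s y = exp (- (real q + 1) * s) * walk_series y x0 s"
        using s y by (simp add: k_def)
      ultimately show ?thesis
        unfolding laplacian_def by (simp add: algebra_simps)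
    qed
    ultimately show "\<exists>D. ((\<lambda>s. k s y) has_real_derivative D) (at s within {0..}) \<and>
        laplacian q G (k s) y + D = 0" by blast
  next
    show "k 0 y = (if y = x0 then 1 else 0)" if "y \<in> verts G" for y
      using that by (simp add: k_def walk_series_0)
  qed
  have "(THE u. bounded_heat_solution q G x0 u \<and> (\<forall>s y. s < 0 \<or> y \<notin> verts G \<longrightarrow> u s y = 0)) = k"
  proof (rule the_equality)
    show "bounded_heat_solution q G x0 k \<and> (\<forall>s y. s < 0 \<or> y \<notin> verts G \<longrightarrow> k s y = 0)"
      using sol by (simp add: k_def)
  next
    fix u assume u: "bounded_heat_solution q G x0 u \<and> (\<forall>s y. s < 0 \<or> y \<notin> verts G \<longrightarrow> u s y = 0)"
    show "u = k"
    proof (intro ext)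
      fix s y
      show "u s y = k s y"
      proof (cases "s < 0 \<or> y \<notin> verts G")
        case True
        then have "u s y = 0" using u by blast
        then show ?thesis using True by (auto simp: k_def)
      next
        case False
        then show ?thesis using u by (intro bounded_heat_solution_unique[OF _ sol]) auto
      qed
    qed
  qed
  then show ?thesis using t x by (simp add: heat_kernel_def k_def)
qed

end

section \<open>Bessel series and the heat kernel formula\<close>

lemma summable_bessel_weight:
  "summable (\<lambda>n. real (bessel_weight q n m) / fact n * t ^ n)"
proof (rule summable_exponential_bound[where K = "real q + 1"])
  show "\<bar>real (bessel_weight q n m)\<bar> \<le> (real q + 1) ^ n" for n
    using bessel_weight_le[of q n m]
    by (metis abs_of_nat of_nat_1 of_nat_add of_nat_le_iff of_nat_power)
qed

lemma I_Bessel_sums: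
  assumes q: "q > 0"
  shows "(\<lambda>n. real (bessel_weight q n m) / fact n * t ^ n) sums
    (real q powr (- real m / 2) * I_Bessel m (2 * sqrt (real q) * t))"
proof -
  let ?a = "\<lambda>n. real (bessel_weight q n m) / fact n * t ^ n"
  let ?b = "\<lambda>j. ((2 * sqrt (real q) * t) / 2) ^ (2 * j + m) / (fact j * Gamma (real (j + 1 + m)))"
  define c where "c = real q powr (- real m / 2)"
  have c: "c * sqrt (real q) ^ m = 1"
  proof -
    have "sqrt (real q) ^ m = real q powr (real m / 2)"
      using q by (simp add: powr_half_sqrt[symmetric] powr_powr powr_realpow[symmetric])
    then show ?thesis using q by (simp add: c_def powr_add[symmetric])
  qed
  have c0: "c \<noteq> 0" using q by (simp add: c_def)
  have ab: "?a (m + 2 * j) = c * ?b j" for j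
  proof -
    have "Gamma (real (j + 1 + m)) = fact (m + j)"
      using Gamma_fact[of "m + j", where 'a = real] by (simp add: algebra_simps)
    moreover have "sqrt (real q) ^ (2 * j + m) = real q ^ j * sqrt (real q) ^ m"
      by (simp add: power_add power_mult)
    ultimately have "c * ?b j = (c * sqrt (real q) ^ m) * (real q ^ j * t ^ (2 * j + m) / (fact j * fact (m + j)))"
      by (simp add: power_mult_distrib)
    also have "\<dots> = real q ^ j * t ^ (2 * j + m) / (fact j * fact (m + j))"
      by (simp add: c)
    also have "\<dots> = ?a (m + 2 * j)"
      using binomial_fact[of j "m + 2 * j", where 'a = real]
      unfolding bessel_weight_add by (simp add: add.commute mult_2)
    finally show ?thesis ..
  qed
  have "?a sums suminf ?a" by (rule summable_sums[OF summable_bessel_weight])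
  then have "(\<lambda>j. ?a (m + 2 * j)) sums suminf ?a"
    by (subst sums_mono_reindex) (auto simp: strict_mono_def bessel_weight_eq_0)
  then have "(\<lambda>j. c * ?b j) sums suminf ?a" by (simp only: ab)
  then have "?b sums (suminf ?a / c)" using c0 by (rule sums_mult_D)
  then have "I_Bessel m (2 * sqrt (real q) * t) = suminf ?a / c"
    unfolding I_Bessel_def by (rule sums_unique[symmetric])
  then show ?thesis
    using summable_sums[OF summable_bessel_weight[of q m t]] c0 by (simp add: c_def)
qed

lemma sums_swap_nonneg:
  fixes a :: "nat \<Rightarrow> nat \<Rightarrow> real"
  assumes nonneg: "\<And>n k. a n k \<ge> 0"
    and rows: "\<And>n. a n sums r n" and total: "r sums S"
    and cols: "\<And>k. (\<lambda>n. a n k) sums b k"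
  shows "b sums S"
proof -
  have rows': "((\<lambda>k. (case (n, k) of (n, k) \<Rightarrow> a n k)) has_sum r n) UNIV" for n
    using sums_nonneg_imp_has_sum[OF rows nonneg] by simp
  have r: "r n \<ge> 0" for n
    using sums_le[OF _ sums_zero rows] nonneg by blast
  have total': "(r has_sum S) UNIV"
    by (rule sums_nonneg_imp_has_sum[OF total r])
  have "((\<lambda>(n, k). a n k) has_sum S) (UNIV \<times> UNIV)"
    by (rule has_sum_SigmaI[OF rows' total'], rule summable_on_SigmaI[OF rows'])
       (use total' nonneg in \<open>auto simp: summable_on_def\<close>)
  then have "((\<lambda>(k, n). a n k) has_sum S) (UNIV \<times> UNIV)"
    by (subst (asm) has_sum_swap) (simp add: case_prod_unfold)
  then have "(b has_sum S) UNIV"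
    by (rule has_sum_SigmaD) (use sums_nonneg_imp_has_sum[OF cols nonneg] in simp)
  then show ?thesis by (rule has_sum_imp_sums)
qed

context regular_bidirected_graph
begin

lemma num_walks_tree:
  assumes "tree_graph G bar" and x: "x \<in> verts G"
  shows "num_walks n x x = walk_weight q n 0"
proof -
  have "closed_geodesic G bar z p \<Longrightarrow> p = []" for z p
    using assms(1) by (auto simp: tree_graph_def)
  then have "card (geodesics x m x) = 0" if "m > 0" for m
    using card_geodesics_tree[OF _ x that] by blast
  then have "num_walks n x x = (\<Sum>m\<le>n. if m = 0 then walk_weight q n 0 else 0)"
    unfolding num_walks_conv_geodesics[OF x]
    by (intro sum.cong refl) (use x in \<open>auto simp: geodesics_0\<close>)
  then show ?thesis by simp
qed

text \<open>
  The first term is the number of closed walks of length \<open>n\<close> in the tree, by \<open>num_walks_tree\<close>; the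
  others are the coefficients of the Bessel functions.  This is the theorem in terms of power
  series coefficients.
\<close>

lemma num_walks_closed_geodesics:
  assumes trans: "vertex_transitive G bar" and x: "x \<in> verts G"
  shows "num_walks n x x = walk_weight q n 0 +
    (\<Sum>m=1..n. bessel_weight q n m * num_closed_geodesics G bar x m)"
proof -
  have "num_walks n x x = walk_weight q n 0 + (\<Sum>m=1..n. walk_weight q n m * card (geodesics x m x))"
    using x by (simp add: num_walks_conv_geodesics atMost_atLeast0 sum.atLeast_Suc_atMost geodesics_0)
  also have "(\<Sum>m=1..n. walk_weight q n m * card (geodesics x m x)) =
      (\<Sum>m=1..n. bessel_weight q n m * num_closed_geodesics G bar x m)"
    by (rule sum_walk_weight_eq_sum_bessel_weight)
       (use x card_geodesics_small closed_geodesic_recurrence card_geodesics_vertex_transitive[OF trans]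
         in blast)+
  finally show ?thesis .
qed

end

theorem corollary1p2:
  fixes q :: nat
    and X :: "('v, 'e) pre_digraph" and barX :: "'e \<Rightarrow> 'e" and x0 :: 'v
    and T :: "('w, 'f) pre_digraph" and barT :: "'f \<Rightarrow> 'f" and y0 :: 'w
    and t :: real
  assumes "q > 0"
    and "bidirected_digraph X barX"
    and "regular_graph X (q + 1)"
    and "vertex_transitive X barX"
    and "x0 \<in> verts X"
    and "tree_graph T barT"
    and "regular_graph T (q + 1)"
    and "y0 \<in> verts T"
    and "t \<ge> 0"
  shows "summable (\<lambda>k. real (num_closed_geodesics X barX x0 (Suc k)) *
             real q powr (- real (Suc k) / 2) * I_Bessel (Suc k) (2 * sqrt (real q) * t))
         \<and> heat_kernel q X t x0 x0 =
           heat_kernel q T t y0 y0 +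
           exp (- (real q + 1) * t) *
             (\<Sum>k. real (num_closed_geodesics X barX x0 (Suc k)) *
                real q powr (- real (Suc k) / 2) * I_Bessel (Suc k) (2 * sqrt (real q) * t))"
proof -
  interpret X: regular_bidirected_graph X barX q
    using assms by (simp add: regular_bidirected_graph_def regular_bidirected_graph_axioms_def)
  interpret T: regular_bidirected_graph T barT q
    using assms by (simp add: regular_bidirected_graph_def regular_bidirected_graph_axioms_def
        tree_graph_def)
  let ?N = "\<lambda>m. real (num_closed_geodesics X barX x0 m)"
  let ?a = "\<lambda>n k. ?N (Suc k) * (real (bessel_weight q n (Suc k)) / fact n * t ^ n)"
  let ?r = "\<lambda>n. real (X.num_walks n x0 x0) / fact n * t ^ n - real (T.num_walks n y0 y0) / fact n * t ^ n"
  let ?b = "\<lambda>k. ?N (Suc k) * real q powr (- real (Suc k) / 2) * I_Bessel (Suc k) (2 * sqrt (real q) * t)"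
  \<comment> \<open>The double series with terms \<open>?a\<close> is nonnegative.  For fixed \<open>n\<close> it sums to the difference of the
    \<open>n\<close>-th terms of the two walk series, for fixed \<open>k\<close> to the Bessel term of order \<open>k + 1\<close>.\<close>
  have rows: "?a n sums ?r n" for n
  proof -
    have "?r n = (\<Sum>m=1..n. real (bessel_weight q n m) * ?N m) / fact n * t ^ n"
      unfolding X.num_walks_closed_geodesics[OF assms(4,5)] T.num_walks_tree[OF assms(6,8)]
      by (simp add: add_divide_distrib distrib_right)
    also have "\<dots> = (\<Sum>m=1..n. ?N m * (real (bessel_weight q n m) / fact n * t ^ n))"
      unfolding sum_divide_distrib sum_distrib_right by (intro sum.cong refl) simp
    also have "\<dots> = sum (?a n) {..<n}"
      by (rule sum.reindex_bij_witness[of _ Suc "\<lambda>m. m - 1"]) auto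
    finally show ?thesis
      by (simp only:) (rule sums_finite, auto simp: bessel_weight_def)
  qed
  have total: "?r sums (X.walk_series x0 x0 t - T.walk_series y0 y0 t)"
    unfolding X.walk_series_def T.walk_series_def
    using assms by (intro sums_diff summable_sums X.summable_walk_series T.summable_walk_series)
  have cols: "(\<lambda>n. ?a n k) sums ?b k" for k
    using sums_mult[OF I_Bessel_sums[OF assms(1), of "Suc k" t], of "?N (Suc k)"]
    by (simp only: mult.assoc)
  have sums: "?b sums (X.walk_series x0 x0 t - T.walk_series y0 y0 t)"
    by (rule sums_swap_nonneg[OF _ rows total cols]) (use assms in simp)
  have "heat_kernel q X t x0 x0 = heat_kernel q T t y0 y0 + exp (- (real q + 1) * t) * suminf ?b"
    unfolding X.heat_kernel_eq_walk_series[OF assms(9,5)]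
      T.heat_kernel_eq_walk_series[OF assms(9,8)] sums_unique[OF sums, symmetric]
    by (simp add: right_diff_distrib)
  with sums show ?thesis by (auto simp: sums_summable)
qed

end
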